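(* Let $a>0$, $\lambda>1$, $\mu=\sqrt{\lambda^2-1}$, let $\alpha(t)=(\lambda t,\cosh t,\sinh t)$, $t\in\mathbb{R}$ (a spacelike helix of $\mathbb{L}^3$ of type I with spacelike axis), and let $V(t)=\sinh(at)\,\mathbf{n}(t)+\cosh(at)\,\mathbf{b}(t)$, where $$\mathbf{n}(t)=(0,\cosh t,\sinh t),\qquad \mathbf{b}(t)=-\frac1\mu(1,\lambda\sinh t,\lambda\cosh t).$$ Then the Björling surface $X=(X_1,X_2,X_3)$ with data $\alpha$ and $V$ is parametrized as follows. If $a\neq1$: $$X_1=\lambda u-\frac{\sinh(au)\sin(av)}{a},$$ $$X_2=\frac{\cosh u\Big((a^2-1)\cos v+\cosh(au)\big((a\mu+\lambda)\cos v\sin(av)-(a\lambda+\mu)\sin v\cos(av)\big)\Big)}{a^2-1}+\frac{\sinh u\sinh(au)\big((a\mu+\lambda)\sin v\cos(av)-(a\lambda+\mu)\cos v\sin(av)\big)}{a^2-1},$$ $$X_3=\frac{\sinh u\Big((a^2-1)\cos v+\cosh(au)\big((a\mu+\lambda)\cos v\sin(av)-(a\lambda+\mu)\sin v\cos(av)\big)\Big)}{a^2-1}+\frac{\cosh u\sinh(au)\big((a\mu+\lambda)\sin v\cos(av)-(a\lambda+\mu)\cos v\sin(av)\big)}{a^2-1}.$$ If $a=1$: $$X_1=\lambda u-\sinh u\sin v,$$ $$X_2=\tfrac12\Big((\mu-\lambda)(\sinh^2u+\cosh^2u)\sin v\cos v+2\cosh u\cos v+(\mu+\lambda)v\Big),$$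 $$X_3=\sinh u\cos v\big((\mu-\lambda)\cosh u\sin v+1\big).$$
   Context: $\mathbb{L}^3$ is $\mathbb{R}^3$ with the metric $\langle,\rangle=dx^2+dy^2-dz^2$. The Lorentzian cross product is $(x_1,x_2,x_3)\times(y_1,y_2,y_3)=(x_2y_3-x_3y_2,\ x_3y_1-x_1y_3,\ -(x_1y_2-x_2y_1))$, extended complex-bilinearly. A maximal surface is a spacelike surface (induced metric Riemannian) with zero mean curvature everywhere. Björling problem: given a real analytic spacelike curve $\alpha:I\to\mathbb{L}^3$ and a real analytic unit timelike vector field $V$ along $\alpha$ with $\langle V,\alpha'\rangle=0$, find a maximal surface containing $\alpha$ with unit normal $V$ along $\alpha$. Its solution (the Björling surface with data $\alpha,V$, unique with $\alpha$ being the parameter curve $v=0$) is $$X(u,v)=\mathrm{Re}\left(\alpha(z)+i\int_{u_0}^z V(w)\times\alpha'(w)\,dw\right),\qquad z=u+iv,$$ where $u_0\in I$ is fixed and $\alpha(z),V(z)$ are the holomorphic extensions of $\alpha,V$ to a simply-connected domain of $\mathbb{C}$ containing $I\times\{0\}$. Maximality is understood away from points where $X$ fails to be an immersion with nondegenerate induced metric. *)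

theory Defs
  imports "HOL-Complex_Analysis.Complex_Analysis"
begin

text \<open>
  Vectors of Lorentz-Minkowski 3-space are elements of \<^typ>\<open>real^3\<close>. The metric and the cross
  product are polymorphic in the scalars, so that their complex-bilinear extensions are the
  instances at \<^typ>\<open>complex^3\<close>.
\<close>

definition lprod :: "'a::comm_ring_1^3 \<Rightarrow> 'a^3 \<Rightarrow> 'a" where
  "lprod x y = x$1 * y$1 + x$2 * y$2 - x$3 * y$3"

definition lcross :: "'a::comm_ring_1^3 \<Rightarrow> 'a^3 \<Rightarrow> 'a^3" where
  "lcross x y = vector [x$2 * y$3 - x$3 * y$2, x$3 * y$1 - x$1 * y$3, - (x$1 * y$2 - x$2 * y$1)]"


subsection \<open>Maximal surfaces\<close>

text \<open>
  A surface is a map \<open>X u v\<close>; its parameter domain is a set of complex numbers \<open>u + iv\<close>.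
\<close>

definition pd_u :: "(real \<Rightarrow> real \<Rightarrow> real^3) \<Rightarrow> real \<Rightarrow> real \<Rightarrow> real^3" where
  "pd_u X u v = vector_derivative (\<lambda>s. X s v) (at u)"

definition pd_v :: "(real \<Rightarrow> real \<Rightarrow> real^3) \<Rightarrow> real \<Rightarrow> real \<Rightarrow> real^3" where
  "pd_v X u v = vector_derivative (\<lambda>t. X u t) (at v)"

fun Ck_surface :: "nat \<Rightarrow> complex set \<Rightarrow> (real \<Rightarrow> real \<Rightarrow> real^3) \<Rightarrow> bool" where
  "Ck_surface 0 \<Omega> X \<longleftrightarrow> continuous_on \<Omega> (\<lambda>z. X (Re z) (Im z))"
| "Ck_surface (Suc k) \<Omega> X \<longleftrightarrow>
     (\<forall>u v. Complex u v \<in> \<Omega> \<longrightarrow>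
        (\<lambda>s. X s v) differentiable (at u) \<and> (\<lambda>t. X u t) differentiable (at v)) \<and>
     Ck_surface k \<Omega> (pd_u X) \<and> Ck_surface k \<Omega> (pd_v X)"

definition fund_E :: "(real \<Rightarrow> real \<Rightarrow> real^3) \<Rightarrow> real \<Rightarrow> real \<Rightarrow> real" where
  "fund_E X u v = lprod (pd_u X u v) (pd_u X u v)"

definition fund_F :: "(real \<Rightarrow> real \<Rightarrow> real^3) \<Rightarrow> real \<Rightarrow> real \<Rightarrow> real" where
  "fund_F X u v = lprod (pd_u X u v) (pd_v X u v)"

definition fund_G :: "(real \<Rightarrow> real \<Rightarrow> real^3) \<Rightarrow> real \<Rightarrow> real \<Rightarrow> real" where
  "fund_G X u v = lprod (pd_v X u v) (pd_v X u v)"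

definition metric_det :: "(real \<Rightarrow> real \<Rightarrow> real^3) \<Rightarrow> real \<Rightarrow> real \<Rightarrow> real" where
  "metric_det X u v = fund_E X u v * fund_G X u v - (fund_F X u v)\<^sup>2"

text \<open>
  A nonzero determinant forces the partial derivatives to be linearly independent, so it says
  that \<open>X\<close> is an immersion with nondegenerate induced metric at the point.
\<close>

definition nondegenerate_at :: "(real \<Rightarrow> real \<Rightarrow> real^3) \<Rightarrow> real \<Rightarrow> real \<Rightarrow> bool" where
  "nondegenerate_at X u v \<longleftrightarrow> metric_det X u v \<noteq> 0"

definition spacelike_at :: "(real \<Rightarrow> real \<Rightarrow> real^3) \<Rightarrow> real \<Rightarrow> real \<Rightarrow> bool" where
  "spacelike_at X u v \<longleftrightarrow>
     (\<forall>p q. (p, q) \<noteq> (0, 0) \<longrightarrow>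
        lprod (p *\<^sub>R pd_u X u v + q *\<^sub>R pd_v X u v) (p *\<^sub>R pd_u X u v + q *\<^sub>R pd_v X u v) > 0)"

definition unit_normal :: "(real \<Rightarrow> real \<Rightarrow> real^3) \<Rightarrow> real \<Rightarrow> real \<Rightarrow> real^3" where
  "unit_normal X u v =
     (let c = lcross (pd_u X u v) (pd_v X u v) in (1 / sqrt \<bar>lprod c c\<bar>) *\<^sub>R c)"

text \<open>
  The second fundamental form is taken with respect to \<^const>\<open>unit_normal\<close>. The causal character
  of the normal contributes only an overall sign, which is irrelevant for vanishing.
\<close>

definition mean_curvature :: "(real \<Rightarrow> real \<Rightarrow> real^3) \<Rightarrow> real \<Rightarrow> real \<Rightarrow> real" where
  "mean_curvature X u v =
     (let N = unit_normal X u v;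
          e = lprod (pd_u (pd_u X) u v) N;
          f = lprod (pd_v (pd_u X) u v) N;
          g = lprod (pd_v (pd_v X) u v) N
      in (e * fund_G X u v - 2 * f * fund_F X u v + g * fund_E X u v) / (2 * metric_det X u v))"

definition maximal_surface :: "complex set \<Rightarrow> (real \<Rightarrow> real \<Rightarrow> real^3) \<Rightarrow> bool" where
  "maximal_surface \<Omega> X \<longleftrightarrow>
     (\<forall>k. Ck_surface k \<Omega> X) \<and>
     (\<forall>u v. Complex u v \<in> \<Omega> \<and> nondegenerate_at X u v \<longrightarrow>
        spacelike_at X u v \<and> mean_curvature X u v = 0)"


subsection \<open>The Bjoerling problem and its solution\<close>

definition real_analytic_curve :: "real set \<Rightarrow> (real \<Rightarrow> real^3) \<Rightarrow> bool" where
  "real_analytic_curve I \<alpha> \<longleftrightarrow>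
     (\<forall>t\<^sub>0\<in>I. \<exists>r>0. \<exists>c :: nat \<Rightarrow> real^3.
        \<forall>t. \<bar>t - t\<^sub>0\<bar> < r \<longrightarrow> (\<lambda>n. (t - t\<^sub>0) ^ n *\<^sub>R c n) sums \<alpha> t)"

definition bjorling_data :: "real set \<Rightarrow> (real \<Rightarrow> real^3) \<Rightarrow> (real \<Rightarrow> real^3) \<Rightarrow> bool" where
  "bjorling_data I \<alpha> V \<longleftrightarrow>
     open I \<and> is_interval I \<and> I \<noteq> {} \<and>
     real_analytic_curve I \<alpha> \<and> real_analytic_curve I V \<and>
     (\<forall>t\<in>I. lprod (vector_derivative \<alpha> (at t)) (vector_derivative \<alpha> (at t)) > 0 \<and>
            lprod (V t) (V t) = -1 \<and>
            lprod (V t) (vector_derivative \<alpha> (at t)) = 0)"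

definition solves_bjorling_problem ::
  "real set \<Rightarrow> (real \<Rightarrow> real^3) \<Rightarrow> (real \<Rightarrow> real^3) \<Rightarrow> complex set \<Rightarrow> (real \<Rightarrow> real \<Rightarrow> real^3) \<Rightarrow> bool" where
  "solves_bjorling_problem I \<alpha> V \<Omega> X \<longleftrightarrow>
     bjorling_data I \<alpha> V \<and> of_real ` I \<subseteq> \<Omega> \<and>
     maximal_surface \<Omega> X \<and>
     (\<forall>t\<in>I. X t 0 = \<alpha> t \<and> nondegenerate_at X t 0 \<and> unit_normal X t 0 = V t)"

definition holomorphic_extension ::
  "real set \<Rightarrow> complex set \<Rightarrow> (real \<Rightarrow> real^3) \<Rightarrow> (complex \<Rightarrow> complex^3) \<Rightarrow> bool" where
  "holomorphic_extension I \<Omega> \<alpha> A \<longleftrightarrow>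
     (\<forall>k. (\<lambda>z. A z $ k) holomorphic_on \<Omega>) \<and>
     (\<forall>t\<in>I. \<forall>k. A (of_real t) $ k = of_real (\<alpha> t $ k))"

definition cvec_deriv :: "(complex \<Rightarrow> complex^3) \<Rightarrow> complex \<Rightarrow> complex^3" where
  "cvec_deriv A w = (\<chi> k. deriv (\<lambda>z. A z $ k) w)"

text \<open>
  The integral is path independent because \<open>\<Omega>\<close> is simply connected; the formula is required for
  every path from \<open>u\<^sub>0\<close> to \<open>z\<close> in \<open>\<Omega>\<close>. Note that \<^const>\<open>simply_connected\<close> includes path
  connectedness.
\<close>

definition bjorling_surface ::
  "real set \<Rightarrow> (real \<Rightarrow> real^3) \<Rightarrow> (real \<Rightarrow> real^3) \<Rightarrow> complex set \<Rightarrow> real \<Rightarrow>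
   (real \<Rightarrow> real \<Rightarrow> real^3) \<Rightarrow> bool" where
  "bjorling_surface I \<alpha> V \<Omega> u\<^sub>0 X \<longleftrightarrow>
     bjorling_data I \<alpha> V \<and> u\<^sub>0 \<in> I \<and>
     open \<Omega> \<and> simply_connected \<Omega> \<and> of_real ` I \<subseteq> \<Omega> \<and>
     (\<exists>A W. holomorphic_extension I \<Omega> \<alpha> A \<and> holomorphic_extension I \<Omega> V W \<and>
        (\<forall>u v \<gamma>. Complex u v \<in> \<Omega> \<and> valid_path \<gamma> \<and> path_image \<gamma> \<subseteq> \<Omega> \<and>
            pathstart \<gamma> = of_real u\<^sub>0 \<and> pathfinish \<gamma> = Complex u v \<longrightarrow>
            X u v = (\<chi> k. Re (A (Complex u v) $ k +
              \<i> * contour_integral \<gamma> (\<lambda>w. lcross (W w) (cvec_deriv A w) $ k)))))"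

end

theory Submission
  imports Defs
begin

text \<open>
  Let \<open>A\<close>, \<open>W\<close> be the holomorphic extensions of \<open>\<alpha>\<close>, \<open>V\<close> and let \<open>P\<close> be a primitive of \<open>W \<times> A'\<close>. By the
  identity theorem every Bjoerling surface is \<open>Re \<Phi>\<close> with \<open>\<Phi> = A + i(P - P(u\<^sub>0))\<close>, which gives
  uniqueness and, with an explicit \<open>P\<close> for the helix, the parametrization. The relations
  \<open>\<langle>W, W\<rangle> = -1\<close> and \<open>\<langle>W, A'\<rangle> = 0\<close> also continue from the real line, and they make \<open>\<Phi>\<close> isotropic:
  \<open>\<langle>\<Phi>', \<Phi>'\<rangle> = 0\<close>. Hence the parameters are conformal (\<open>E = G\<close>, \<open>F = 0\<close>); since \<open>Re \<Phi>\<close> is harmonic, its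
  mean curvature vanishes.
\<close>

section \<open>Derivatives along the coordinate lines of the parameter plane\<close>

lemma has_vector_derivative_vecI:
  fixes f :: "real \<Rightarrow> real^'n"
  assumes "\<And>k. ((\<lambda>t. f t $ k) has_vector_derivative D $ k) (at x within S)"
  shows "(f has_vector_derivative D) (at x within S)"
  using assms
  by (auto simp: has_vector_derivative_def has_derivative_componentwise_within[of f]
      Basis_vec_def cart_eq_inner_axis [symmetric])

lemma has_vector_derivative_along_line:
  fixes f :: "complex \<Rightarrow> complex" and g :: "real \<Rightarrow> complex" and x :: real
  assumes "(f has_field_derivative d) (at (g x))" and "(g has_vector_derivative c) (at x)"
  shows "((\<lambda>s. f (g s)) has_vector_derivative c * d) (at x)"
  using field_vector_diff_chain_at[OF assms(2,1)] by (simp add: o_def)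

lemma has_vector_derivative_complex_of_real: "(of_real has_vector_derivative 1) (at x)"
  using has_vector_derivative_of_real[of "\<lambda>x. x" 1 "at x"] by simp

lemma has_vector_derivative_Complex_left: "((\<lambda>s. Complex s v) has_vector_derivative 1) (at u)"
  unfolding Complex_eq by (auto intro!: derivative_eq_intros has_vector_derivative_complex_of_real)

lemma has_vector_derivative_Complex_right: "((\<lambda>t. Complex u t) has_vector_derivative \<i>) (at v)"
proof -
  have "((\<lambda>t. of_real u + \<i> * of_real t) has_vector_derivative 0 + \<i> * 1) (at v)"
    by (intro has_vector_derivative_add has_vector_derivative_const
        has_vector_derivative_mult_right has_vector_derivative_complex_of_real)
  then show ?thesis by (simp add: Complex_eq)
qed

lemma open_vimage_Complex:
  assumes "open \<Omega>"
  shows "open {s. Complex s v \<in> \<Omega>}" and "open {t. Complex u t \<in> \<Omega>}"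
proof -
  have "continuous_on UNIV (\<lambda>s. Complex s v)" "continuous_on UNIV (\<lambda>t. Complex u t)"
    unfolding Complex_eq by (intro continuous_intros)+
  then show "open {s. Complex s v \<in> \<Omega>}" "open {t. Complex u t \<in> \<Omega>}"
    using open_vimage[OF assms] by (auto simp: vimage_def)
qed

section \<open>Surfaces that are real parts of holomorphic curves\<close>

text \<open>Moving in \<open>u\<close> or \<open>v\<close> differentiates \<open>\<Phi> k\<close> in
  the direction \<open>1\<close> or \<open>\<i>\<close>, and \<open>Re\<close> is bounded linear. As
  \<open>X\<close> is prescribed only on \<open>\<Omega>\<close>, openness of the coordinate slices
  is what transfers the derivatives.\<close>

lemma Re_holomorphic_partials:
  fixes \<Phi> :: "3 \<Rightarrow> complex \<Rightarrow> complex"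
  assumes \<Omega>: "open \<Omega>" and hol: "\<And>k. \<Phi> k holomorphic_on \<Omega>"
    and X: "\<And>u v. Complex u v \<in> \<Omega> \<Longrightarrow> X u v = (\<chi> k. Re (\<Phi> k (Complex u v)))"
    and uv: "Complex u v \<in> \<Omega>"
  shows "((\<lambda>s. X s v) has_vector_derivative (\<chi> k. Re (deriv (\<Phi> k) (Complex u v)))) (at u)" (is ?u)
    and "((\<lambda>t. X u t) has_vector_derivative (\<chi> k. Re (\<i> * deriv (\<Phi> k) (Complex u v)))) (at v)" (is ?v)
proof -
  have d: "(\<Phi> k has_field_derivative deriv (\<Phi> k) (Complex u v)) (at (Complex u v))" for k
    using hol \<Omega> uv by (rule holomorphic_derivI)
  have "((\<lambda>s. \<chi> k. Re (\<Phi> k (Complex s v))) has_vector_derivative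
      (\<chi> k. Re (deriv (\<Phi> k) (Complex u v)))) (at u)"
    using has_vector_derivative_along_line[OF d has_vector_derivative_Complex_left]
    by (intro has_vector_derivative_vecI)
      (auto intro!: bounded_linear.has_vector_derivative[OF bounded_linear_Re])
  then show ?u
    by (rule has_vector_derivative_transform_within_open[OF _ open_vimage_Complex(1)[OF \<Omega>]])
      (use X uv in auto)
  have "((\<lambda>t. \<chi> k. Re (\<Phi> k (Complex u t))) has_vector_derivative
      (\<chi> k. Re (\<i> * deriv (\<Phi> k) (Complex u v)))) (at v)"
    using bounded_linear.has_vector_derivative[OF bounded_linear_Re
        has_vector_derivative_along_line[OF d has_vector_derivative_Complex_right]]
    by (intro has_vector_derivative_vecI) auto
  then show ?v
    by (rule has_vector_derivative_transform_within_open[OF _ open_vimage_Complex(2)[OF \<Omega>]])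
      (use X uv in auto)
qed

lemma Re_holomorphic_pd:
  fixes \<Phi> :: "3 \<Rightarrow> complex \<Rightarrow> complex"
  assumes "open \<Omega>" and "\<And>k. \<Phi> k holomorphic_on \<Omega>"
    and "\<And>u v. Complex u v \<in> \<Omega> \<Longrightarrow> X u v = (\<chi> k. Re (\<Phi> k (Complex u v)))"
    and "Complex u v \<in> \<Omega>"
  shows "pd_u X u v = (\<chi> k. Re (deriv (\<Phi> k) (Complex u v)))"
    and "pd_v X u v = (\<chi> k. Re (\<i> * deriv (\<Phi> k) (Complex u v)))"
  unfolding pd_u_def pd_v_def
  using Re_holomorphic_partials[where \<Phi>=\<Phi> and X=X, OF assms] by (simp_all add: vector_derivative_at)

text \<open>The class of real parts of holomorphic curves is closed under both partials, with
  \<Phi>' and i \<Phi>' replacing \<Phi>. The induction therefore varies \<open>\<Phi>\<close> and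
  \<open>X\<close>.\<close>

lemma Re_holomorphic_Ck_surface:
  fixes \<Phi> :: "3 \<Rightarrow> complex \<Rightarrow> complex"
  assumes "open \<Omega>" and "\<And>k. \<Phi> k holomorphic_on \<Omega>"
    and "\<And>u v. Complex u v \<in> \<Omega> \<Longrightarrow> X u v = (\<chi> k. Re (\<Phi> k (Complex u v)))"
  shows "Ck_surface m \<Omega> X"
  using assms(2-)
proof (induction m arbitrary: \<Phi> X)
  case 0
  have "continuous_on \<Omega> (\<lambda>z. \<chi> k. Re (\<Phi> k z))"
    using 0(1) by (intro continuous_on_vec_lambda continuous_intros holomorphic_on_imp_continuous_on)
  then show ?case
    using 0(2) by (auto cong: continuous_on_cong)
next
  case (Suc m)
  have holD: "deriv (\<Phi> k) holomorphic_on \<Omega>" for k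
    using Suc.prems(1) assms(1) by (intro holomorphic_deriv)
  have "Ck_surface m \<Omega> (pd_u X)"
    using holD Re_holomorphic_pd(1)[OF assms(1) Suc.prems] by (intro Suc.IH[of "\<lambda>k. deriv (\<Phi> k)"])
  moreover have "Ck_surface m \<Omega> (pd_v X)"
    using Re_holomorphic_pd(2)[OF assms(1) Suc.prems]
    by (intro Suc.IH[of "\<lambda>k z. \<i> * deriv (\<Phi> k) z"] holomorphic_on_mult holomorphic_on_const holD)
  moreover have "(\<lambda>s. X s v) differentiable (at u)" "(\<lambda>t. X u t) differentiable (at v)"
    if "Complex u v \<in> \<Omega>" for u v
    using Re_holomorphic_partials[OF assms(1) Suc.prems, of u v] that
    by (blast intro: differentiableI_vector)+
  ultimately show ?case
    by simp
qed

text \<open>The signature is (2,1), so it leaves no room for two orthogonal timelike directions.\<close>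

lemma lprod_orthogonal_nonneg:
  fixes x y :: "real^3"
  assumes "lprod x x = lprod y y" and "lprod x y = 0"
  shows "lprod x x \<ge> 0"
proof (rule ccontr)
  assume neg: "\<not> lprod x x \<ge> 0"
  let ?p = "(x$1)\<^sup>2 + (x$2)\<^sup>2" and ?q = "(y$1)\<^sup>2 + (y$2)\<^sup>2"
  have "?p < (x$3)\<^sup>2" "?q < (y$3)\<^sup>2"
    using neg assms(1) by (auto simp: lprod_def power2_eq_square)
  then have "?p * ?q < (x$3)\<^sup>2 * (y$3)\<^sup>2"
    by (intro mult_strict_mono') auto
  also have "\<dots> = (x$1 * y$1 + x$2 * y$2)\<^sup>2"
    using assms(2) by (simp add: lprod_def flip: power_mult_distrib)
  \<comment> \<open>Lagrange's identity in the plane. The chain now says \<open>?p * ?q\<close> is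
    strictly less than itself minus a square.\<close>
  also have "\<dots> = ?p * ?q - (x$1 * y$2 - x$2 * y$1)\<^sup>2"
    by (simp add: power2_eq_square algebra_simps)
  finally show False
    by (smt (verit) zero_le_power2)
qed

text \<open>Isotropy alone leaves the sign of \<open>E\<close> open. A negative \<open>E = G\<close>
  with \<open>F = 0\<close> would give two orthogonal timelike directions, so nondegeneracy forces a
  positive definite metric.\<close>

lemma Re_isotropic_maximal_surface:
  fixes \<Phi> :: "3 \<Rightarrow> complex \<Rightarrow> complex"
  assumes \<Omega>: "open \<Omega>" and hol: "\<And>k. \<Phi> k holomorphic_on \<Omega>"
    and X: "\<And>u v. Complex u v \<in> \<Omega> \<Longrightarrow> X u v = (\<chi> k. Re (\<Phi> k (Complex u v)))"
    and iso: "\<And>z. z \<in> \<Omega> \<Longrightarrow> lprod (\<chi> k. deriv (\<Phi> k) z) (\<chi> k. deriv (\<Phi> k) z) = 0"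
  shows "maximal_surface \<Omega> X"
  unfolding maximal_surface_def
proof (intro conjI allI impI; (elim conjE)?)
  show "Ck_surface k \<Omega> X" for k
    using \<Omega> hol X by (rule Re_holomorphic_Ck_surface)
next
  fix u v
  assume uv: "Complex u v \<in> \<Omega>" and nd: "nondegenerate_at X u v"
  let ?z = "Complex u v"
  have holD: "deriv (\<Phi> k) holomorphic_on \<Omega>" for k
    using hol \<Omega> by (intro holomorphic_deriv)
  note pd = Re_holomorphic_pd[OF \<Omega> hol X]
  have pdu: "pd_u X u v = (\<chi> k. Re (deriv (\<Phi> k) ?z))"
    and pdv: "pd_v X u v = (\<chi> k. Re (\<i> * deriv (\<Phi> k) ?z))"
    using pd uv by auto
  have "pd_u (pd_u X) u v = (\<chi> k. Re (deriv (deriv (\<Phi> k)) ?z))"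
    using pd(1) uv by (intro Re_holomorphic_pd(1)[OF \<Omega>, where \<Phi> = "\<lambda>k. deriv (\<Phi> k)"] holD)
  moreover have "pd_v (pd_v X) u v = (\<chi> k. Re (\<i> * deriv (\<lambda>z. \<i> * deriv (\<Phi> k) z) ?z))"
    using pd(2) uv
    by (intro Re_holomorphic_pd(2)[OF \<Omega>, where \<Phi> = "\<lambda>k z. \<i> * deriv (\<Phi> k) z"]
        holomorphic_on_mult holomorphic_on_const holD)
  moreover have "deriv (\<lambda>z. \<i> * deriv (\<Phi> k) z) ?z = \<i> * deriv (deriv (\<Phi> k)) ?z" for k
    using holomorphic_on_imp_differentiable_at[OF holD \<Omega> uv] by (rule deriv_cmult)
  \<comment> \<open>Two \<open>v\<close>-derivatives contribute the factor
    \<open>\<i> * \<i> = -1\<close>.\<close>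
  ultimately have harmonic: "pd_v (pd_v X) u v = - pd_u (pd_u X) u v"
    by (simp add: vec_eq_iff)
  define \<phi> where "\<phi> k = deriv (\<Phi> k) ?z" for k
  have "lprod (\<chi> k. \<phi> k) (\<chi> k. \<phi> k) = 0"
    using iso[OF uv] by (simp add: \<phi>_def)
  \<comment> \<open>Since X_u = Re \<phi> and X_v = - Im \<phi>, these two numbers are E - G and
    -2F.\<close>
  then have "Re (\<phi> 1 * \<phi> 1 + \<phi> 2 * \<phi> 2 - \<phi> 3 * \<phi> 3) = 0" "Im (\<phi> 1 * \<phi> 1 + \<phi> 2 * \<phi> 2 - \<phi> 3 * \<phi> 3) = 0"
    by (simp_all add: lprod_def)
  then have EGF: "fund_E X u v = fund_G X u v" "fund_F X u v = 0"
    unfolding fund_E_def fund_F_def fund_G_def pdu pdv lprod_def \<phi>_def[symmetric]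
    by (simp_all add: mult.commute)
  then have Ene: "fund_E X u v \<noteq> 0"
    using nd by (auto simp: nondegenerate_at_def metric_det_def)
  moreover have "fund_E X u v \<ge> 0"
    using lprod_orthogonal_nonneg EGF by (auto simp: fund_E_def fund_F_def fund_G_def)
  ultimately have Epos: "fund_E X u v > 0" by simp
  have comb: "lprod (p *\<^sub>R x + q *\<^sub>R y) (p *\<^sub>R x + q *\<^sub>R y)
      = p\<^sup>2 * lprod x x + 2 * p * q * lprod x y + q\<^sup>2 * lprod y y" for p q :: real and x y :: "real^3"
    by (simp add: lprod_def power2_eq_square algebra_simps)
  show "spacelike_at X u v"
    unfolding spacelike_at_def
  proof (intro allI impI)
    fix p q :: real
    assume "(p, q) \<noteq> (0, 0)"
    then have "p\<^sup>2 + q\<^sup>2 > 0"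
      by (auto simp: sum_power2_gt_zero_iff)
    then have "(p\<^sup>2 + q\<^sup>2) * fund_E X u v > 0"
      using Epos by simp
    then show "lprod (p *\<^sub>R pd_u X u v + q *\<^sub>R pd_v X u v) (p *\<^sub>R pd_u X u v + q *\<^sub>R pd_v X u v) > 0"
      unfolding comb using EGF by (simp add: fund_E_def fund_F_def fund_G_def algebra_simps)
  qed
  \<comment> \<open>For E = G and F = 0 the numerator of the mean curvature is E(e + g), and
    harmonicity gives g = -e.\<close>
  have "lprod (- x) y = - lprod x y" for x y :: "real^3"
    by (simp add: lprod_def)
  then show "mean_curvature X u v = 0"
    using EGF harmonic by (simp add: mean_curvature_def Let_def)
qed

section \<open>The Bjoerling formula\<close>

lemma identity_theorem_real_line:
  assumes "f holomorphic_on \<Omega>" "g holomorphic_on \<Omega>" "open \<Omega>" "connected \<Omega>"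
    and I: "open I" "I \<noteq> {}" "of_real ` I \<subseteq> \<Omega>"
    and eq: "\<And>t. t \<in> I \<Longrightarrow> f (of_real t) = g (of_real t)" and z: "z \<in> \<Omega>"
  shows "f z = g z"
proof -
  obtain t where t: "t \<in> I" using I(2) by blast
  \<comment> \<open>A point of an open real set is a limit point of it. Its complex image is thus a
    limit point of zeros of \<open>f - g\<close>, which is what analytic continuation
    requires.\<close>
  have "t islimpt I"
    using t I(1) by (simp add: interior_limit_point interior_open)
  then have "complex_of_real t islimpt of_real ` I"
    by (rule islimpt_isCont_image) (simp_all add: eventually_at_filter)
  moreover have "(\<lambda>z. f z - g z) holomorphic_on \<Omega>"
    using assms(1,2) by (rule holomorphic_on_diff)
  moreover have "complex_of_real t \<in> \<Omega>"
    using t I(3) by blast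
  moreover have "f w - g w = 0" if "w \<in> of_real ` I" for w
    using eq that by auto
  ultimately have "f z - g z = 0"
    using analytic_continuation[OF _ assms(3,4) I(3)] z by blast
  then show ?thesis by simp
qed

lemma holomorphic_extension_unique:
  assumes "holomorphic_extension I \<Omega> \<alpha> A" "holomorphic_extension I \<Omega> \<alpha> B"
    and "open \<Omega>" "connected \<Omega>" "open I" "I \<noteq> {}" "of_real ` I \<subseteq> \<Omega>" "z \<in> \<Omega>"
  shows "A z = B z"
proof -
  have "A z $ k = B z $ k" for k
    by (rule identity_theorem_real_line[of "\<lambda>z. A z $ k" \<Omega> "\<lambda>z. B z $ k" I z])
      (use assms in \<open>auto simp: holomorphic_extension_def\<close>)
  then show ?thesis by (simp add: vec_eq_iff)
qed

text \<open>Along the real axis the component of \<open>A\<close> is the real function \<alpha>, so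
  the imaginary part of its derivative is the derivative of 0. The second conclusion certifies that
  \<open>vector_derivative\<close> is a genuine derivative here.\<close>

lemma holomorphic_extension_deriv:
  assumes ext: "holomorphic_extension I \<Omega> \<alpha> A" and \<Omega>: "open \<Omega>" and I: "open I" "of_real ` I \<subseteq> \<Omega>"
    and t: "t \<in> I"
  shows "cvec_deriv A (of_real t) $ k = of_real (vector_derivative \<alpha> (at t) $ k)"
    and "(\<alpha> has_vector_derivative vector_derivative \<alpha> (at t)) (at t)"
proof -
  have d: "((\<lambda>s. A (of_real s) $ k) has_vector_derivative cvec_deriv A (of_real t) $ k) (at t)" for k
  proof -
    have "((\<lambda>z. A z $ k) has_field_derivative cvec_deriv A (of_real t) $ k) (at (of_real t))"
    proof -
      have "(\<lambda>z. A z $ k) holomorphic_on \<Omega>" "complex_of_real t \<in> \<Omega>"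
        using ext I t by (auto simp: holomorphic_extension_def)
      then show ?thesis
        using \<Omega> by (simp add: cvec_deriv_def holomorphic_derivI)
    qed
    from has_vector_derivative_along_line[OF this has_vector_derivative_complex_of_real]
    show ?thesis by simp
  qed
  have dR: "((\<lambda>s. of_real (\<alpha> s $ k)) has_vector_derivative cvec_deriv A (of_real t) $ k) (at t)" for k
    by (rule has_vector_derivative_transform_within_open[OF d I(1) t])
      (use ext in \<open>auto simp: holomorphic_extension_def\<close>)
  have "((\<lambda>s. 0) has_vector_derivative Im (cvec_deriv A (of_real t) $ k)) (at t)" for k
    using bounded_linear.has_vector_derivative[OF bounded_linear_Im dR] by simp
  then have Im0: "Im (cvec_deriv A (of_real t) $ k) = 0" for k
    using has_vector_derivative_const vector_derivative_unique_at by blast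
  have "(\<alpha> has_vector_derivative (\<chi> k. Re (cvec_deriv A (of_real t) $ k))) (at t)"
    using bounded_linear.has_vector_derivative[OF bounded_linear_Re dR]
    by (intro has_vector_derivative_vecI) simp
  then show "(\<alpha> has_vector_derivative vector_derivative \<alpha> (at t)) (at t)"
    and "cvec_deriv A (of_real t) $ k = of_real (vector_derivative \<alpha> (at t) $ k)"
    using Im0 by (simp_all add: vector_derivative_at complex_eq_iff)
qed

text \<open>The real parts of the Taylor coefficients of \<open>A\<close> serve as real
  coefficients, because powers of the real number \<open>t - t\<^sub>0\<close> pass through
  \<open>Re\<close>. The radius keeps \<open>t\<close> both in \<open>I\<close> and in a disc of
  holomorphy.\<close>

lemma holomorphic_extension_real_analytic:
  assumes ext: "holomorphic_extension I \<Omega> \<alpha> A" and \<Omega>: "open \<Omega>" and I: "open I" "of_real ` I \<subseteq> \<Omega>"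
  shows "real_analytic_curve I \<alpha>"
  unfolding real_analytic_curve_def
proof
  fix t\<^sub>0 assume t0: "t\<^sub>0 \<in> I"
  obtain r1 where r1: "r1 > 0" "ball t\<^sub>0 r1 \<subseteq> I"
    using I(1) t0 openE by blast
  obtain r2 where r2: "r2 > 0" "ball (complex_of_real t\<^sub>0) r2 \<subseteq> \<Omega>"
    using openE[OF \<Omega>, of "of_real t\<^sub>0"] I(2) t0 by blast
  define c where "c n = (\<chi> k. Re ((deriv ^^ n) (\<lambda>z. A z $ k) (of_real t\<^sub>0) / fact n))" for n
  have "(\<lambda>n. (t - t\<^sub>0) ^ n *\<^sub>R c n) sums \<alpha> t" if t: "\<bar>t - t\<^sub>0\<bar> < min r1 r2" for t
    unfolding sums_def
  proof (rule vec_tendstoI)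
    fix k
    have tI: "t \<in> I"
      using t r1(2) by (auto simp: dist_real_def abs_minus_commute)
    have Re_eq: "Re (d * (of_real t - of_real t\<^sub>0) ^ n) = (t - t\<^sub>0) ^ n * Re d" for d n
      by (simp flip: of_real_diff of_real_power)
    have "(\<lambda>z. A z $ k) holomorphic_on ball (of_real t\<^sub>0) r2"
      using ext r2(2) by (auto simp: holomorphic_extension_def intro: holomorphic_on_subset)
    moreover have "complex_of_real t \<in> ball (of_real t\<^sub>0) r2"
      using t by (simp add: dist_norm abs_minus_commute flip: of_real_diff)
    ultimately have "(\<lambda>n. (deriv ^^ n) (\<lambda>z. A z $ k) (of_real t\<^sub>0) / fact n
        * (of_real t - of_real t\<^sub>0) ^ n) sums A (of_real t) $ k"
      by (rule holomorphic_power_series)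
    from sums_Re[OF this, unfolded Re_eq]
    have "(\<lambda>n. (t - t\<^sub>0) ^ n * c n $ k) sums \<alpha> t $ k"
      using ext tI by (simp add: c_def holomorphic_extension_def)
    then show "(\<lambda>n. (\<Sum>i<n. (t - t\<^sub>0) ^ i *\<^sub>R c i) $ k) \<longlonglongrightarrow> \<alpha> t $ k"
      by (simp add: sums_def sum_component)
  qed
  then show "\<exists>r>0. \<exists>c. \<forall>t. \<bar>t - t\<^sub>0\<bar> < r \<longrightarrow> (\<lambda>n. (t - t\<^sub>0) ^ n *\<^sub>R c n) sums \<alpha> t"
    using r1(1) r2(1) by (intro exI[of _ "min r1 r2"]) auto
qed

text \<open>This is the uniqueness half. The extensions hidden in the definition coincide on
  \<open>\<Omega>\<close> with the given ones by the identity theorem, and a primitive evaluates the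
  integral.\<close>

lemma bjorling_surface_primitive:
  assumes X: "bjorling_surface I \<alpha> V \<Omega> u\<^sub>0 X"
    and A: "holomorphic_extension I \<Omega> \<alpha> A" and W: "holomorphic_extension I \<Omega> V W"
    and P: "\<And>k z. z \<in> \<Omega> \<Longrightarrow>
      (P k has_field_derivative lcross (W z) (cvec_deriv A z) $ k) (at z)"
    and uv: "Complex u v \<in> \<Omega>"
  shows "X u v = (\<chi> k. Re (A (Complex u v) $ k + \<i> * (P k (Complex u v) - P k (of_real u\<^sub>0))))"
proof -
  let ?z = "Complex u v"
  have \<Omega>: "open \<Omega>" "connected \<Omega>" and I: "open I" "I \<noteq> {}" "of_real ` I \<subseteq> \<Omega>" "u\<^sub>0 \<in> I"
    using X by (auto simp: bjorling_surface_def bjorling_data_def simply_connected_imp_connected)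
  obtain A' W' where A': "holomorphic_extension I \<Omega> \<alpha> A'" and W': "holomorphic_extension I \<Omega> V W'"
    and formula: "\<And>u v \<gamma>. Complex u v \<in> \<Omega> \<Longrightarrow> valid_path \<gamma> \<Longrightarrow> path_image \<gamma> \<subseteq> \<Omega> \<Longrightarrow>
      pathstart \<gamma> = of_real u\<^sub>0 \<Longrightarrow> pathfinish \<gamma> = Complex u v \<Longrightarrow>
      X u v = (\<chi> k. Re (A' (Complex u v) $ k +
        \<i> * contour_integral \<gamma> (\<lambda>w. lcross (W' w) (cvec_deriv A' w) $ k)))"
    using X unfolding bjorling_surface_def by blast
  have AA: "A' z = A z" "W' z = W z" if "z \<in> \<Omega>" for z
    using holomorphic_extension_unique[OF A' A \<Omega> I(1-3) that]
      holomorphic_extension_unique[OF W' W \<Omega> I(1-3) that] by auto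
  have dA: "cvec_deriv A' z = cvec_deriv A z" if "z \<in> \<Omega>" for z
  proof -
    \<comment> \<open>Equality of derivatives needs agreement near \<open>z\<close>, not only at
      \<open>z\<close>; openness of \<open>\<Omega>\<close> supplies it.\<close>
    have "\<forall>\<^sub>F w in nhds z. A' w $ k = A w $ k" for k
      using AA \<Omega>(1) that by (auto simp: eventually_nhds)
    then show ?thesis
      unfolding cvec_deriv_def by (simp add: vec_eq_iff deriv_cong_ev)
  qed
  \<comment> \<open>The defining formula constrains \<open>X\<close> only through paths, so one must
    be exhibited; open connected sets are connected by polynomial paths.\<close>
  have "of_real u\<^sub>0 \<in> \<Omega>" using I by blast
  then obtain \<gamma> where \<gamma>: "valid_path \<gamma>" "path_image \<gamma> \<subseteq> \<Omega>" "pathstart \<gamma> = of_real u\<^sub>0"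
      "pathfinish \<gamma> = ?z"
    using connected_open_polynomial_connected[OF \<Omega> _ uv] valid_path_polynomial_function by metis
  have "contour_integral \<gamma> (\<lambda>w. lcross (W' w) (cvec_deriv A' w) $ k) = P k ?z - P k (of_real u\<^sub>0)" for k
  proof -
    have "contour_integral \<gamma> (\<lambda>w. lcross (W' w) (cvec_deriv A' w) $ k)
        = contour_integral \<gamma> (\<lambda>w. lcross (W w) (cvec_deriv A w) $ k)"
      using \<gamma>(2) AA dA by (intro contour_integral_eq) auto
    also have "\<dots> = P k ?z - P k (of_real u\<^sub>0)"
      using contour_integral_primitive[OF has_field_derivative_at_within[OF P] \<gamma>(1,2)] \<gamma>(3,4)
      by (simp add: contour_integral_unique)
    finally show ?thesis .
  qed
  then show ?thesis
    using formula[OF uv \<gamma>] AA[OF uv] by simp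
qed

text \<open>With a primitive the integral depends only on the endpoints, so a single function
  satisfies the formula for all paths at once.\<close>

lemma bjorling_surface_exists:
  assumes data: "bjorling_data I \<alpha> V" and u0: "u\<^sub>0 \<in> I"
    and \<Omega>: "open \<Omega>" "simply_connected \<Omega>" "of_real ` I \<subseteq> \<Omega>"
    and A: "holomorphic_extension I \<Omega> \<alpha> A" and W: "holomorphic_extension I \<Omega> V W"
    and P: "\<And>k z. z \<in> \<Omega> \<Longrightarrow>
      (P k has_field_derivative lcross (W z) (cvec_deriv A z) $ k) (at z)"
  shows "bjorling_surface I \<alpha> V \<Omega> u\<^sub>0
    (\<lambda>u v. \<chi> k. Re (A (Complex u v) $ k + \<i> * (P k (Complex u v) - P k (of_real u\<^sub>0))))"
proof -
  have "contour_integral \<gamma> (\<lambda>w. lcross (W w) (cvec_deriv A w) $ k)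
      = P k (pathfinish \<gamma>) - P k (pathstart \<gamma>)"
    if "valid_path \<gamma>" "path_image \<gamma> \<subseteq> \<Omega>" for \<gamma> k
    using contour_integral_primitive[OF has_field_derivative_at_within[OF P] that]
    by (simp add: contour_integral_unique)
  then show ?thesis
    unfolding bjorling_surface_def using assms by (intro conjI exI[of _ A] exI[of _ W]) auto
qed

text \<open>Lorentzian Lagrange and triple product identities, with signs opposite to the Euclidean
  ones. The scalars are general because complex vectors give isotropy and real vectors give the unit
  normal.\<close>

lemma lcross_unit_orthogonal:
  fixes w p :: "'a::comm_ring_1^3"
  assumes "lprod w w = -1" and "lprod w p = 0"
  shows "lprod (lcross w p) (lcross w p) = lprod p p" and "lprod p (lcross w p) = 0"
    and "lcross p (lcross w p) = - lprod p p *s w"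
proof -
  have "lprod (lcross w p) (lcross w p) = (lprod w p)\<^sup>2 - lprod w w * lprod p p"
    by (simp add: lprod_def lcross_def power2_eq_square algebra_simps)
  then show "lprod (lcross w p) (lcross w p) = lprod p p"
    using assms by simp
  show "lprod p (lcross w p) = 0"
    by (simp add: lprod_def lcross_def algebra_simps)
  have "lcross p (lcross w p) = lprod w p *s p - lprod p p *s w"
    by (simp add: lprod_def lcross_def vec_eq_iff forall_3 algebra_simps)
  then show "lcross p (lcross w p) = - lprod p p *s w"
    using assms(2) by (simp add: vec_eq_iff)
qed

text \<open>Maximality comes from isotropy of \<Phi>' = A' + iB with B = W \<times> A'. On the real
  axis \<open>A'\<close> and \<open>B\<close> are real, so X_u = \<alpha>' and X_v = - V \<times>
  \<alpha>', which determines the normal.\<close>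

theorem bjorling_surface_solves_problem:
  assumes X: "bjorling_surface I \<alpha> V \<Omega> u\<^sub>0 X"
  shows "solves_bjorling_problem I \<alpha> V \<Omega> X"
proof -
  have \<Omega>: "open \<Omega>" "simply_connected \<Omega>" "connected \<Omega>"
    and I: "open I" "I \<noteq> {}" "of_real ` I \<subseteq> \<Omega>" "is_interval I" and u0: "u\<^sub>0 \<in> I"
    and data: "bjorling_data I \<alpha> V"
    using X by (auto simp: bjorling_surface_def bjorling_data_def simply_connected_imp_connected)
  obtain A W where A: "holomorphic_extension I \<Omega> \<alpha> A" and W: "holomorphic_extension I \<Omega> V W"
    using X unfolding bjorling_surface_def by blast
  have holA: "(\<lambda>z. A z $ k) holomorphic_on \<Omega>" and holW: "(\<lambda>z. W z $ k) holomorphic_on \<Omega>" for k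
    using A W by (auto simp: holomorphic_extension_def)
  have holdA: "(\<lambda>z. cvec_deriv A z $ k) holomorphic_on \<Omega>" for k
    unfolding cvec_deriv_def using holA \<Omega>(1) by (auto intro!: holomorphic_intros)
  define B where "B z = lcross (W z) (cvec_deriv A z)" for z
  have holB: "(\<lambda>z. B z $ k) holomorphic_on \<Omega>" for k
    using exhaust_3[of k]
    by (auto simp: B_def lcross_def intro!: holomorphic_intros holdA holW)
  \<comment> \<open>Simple connectedness is what provides a global primitive of the holomorphic
    integrand.\<close>
  have "\<exists>h. \<forall>z. z \<in> \<Omega> \<longrightarrow> (h has_field_derivative B z $ k) (at z)" for k
    using simply_connected_eq_global_primitive[OF \<Omega>(1)] \<Omega>(2) holB by blast
  then obtain P where P: "\<And>k z. z \<in> \<Omega> \<Longrightarrow> (P k has_field_derivative B z $ k) (at z)"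
    by metis
  define \<Phi> where "\<Phi> k z = A z $ k + \<i> * (P k z - P k (of_real u\<^sub>0))" for k z
  have rep: "X u v = (\<chi> k. Re (\<Phi> k (Complex u v)))" if "Complex u v \<in> \<Omega>" for u v
    using bjorling_surface_primitive[OF X A W P[unfolded B_def] that] by (simp add: \<Phi>_def)
  have d\<Phi>: "(\<Phi> k has_field_derivative cvec_deriv A z $ k + \<i> * B z $ k) (at z)" if "z \<in> \<Omega>" for k z
  proof -
    have "((\<lambda>z. A z $ k) has_field_derivative cvec_deriv A z $ k) (at z)"
      using holomorphic_derivI[OF holA \<Omega>(1) that] by (simp add: cvec_deriv_def)
    then show ?thesis
      unfolding \<Phi>_def[abs_def] using P[OF that] by (auto intro!: derivative_eq_intros)
  qed
  have hol\<Phi>: "\<Phi> k holomorphic_on \<Omega>" for k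
    using d\<Phi> \<Omega>(1) by (auto simp: holomorphic_on_open)
  have deriv\<Phi>: "deriv (\<Phi> k) z = cvec_deriv A z $ k + \<i> * B z $ k" if "z \<in> \<Omega>" for k z
    using d\<Phi>[OF that] by (rule DERIV_imp_deriv)
  have dAt: "cvec_deriv A (of_real t) $ k = of_real (vector_derivative \<alpha> (at t) $ k)"
    and Wt: "W (of_real t) $ k = of_real (V t $ k)"
    and At: "A (of_real t) $ k = of_real (\<alpha> t $ k)" if "t \<in> I" for t k
    using holomorphic_extension_deriv(1)[OF A \<Omega>(1) I(1,3) that] A W that
    by (auto simp: holomorphic_extension_def)
  have Bt: "B (of_real t) $ k = of_real (lcross (V t) (vector_derivative \<alpha> (at t)) $ k)"
    if "t \<in> I" for t k
    using exhaust_3[of k] by (auto simp: B_def lcross_def dAt Wt that)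
  have unit: "lprod (W z) (W z) = -1" and orth: "lprod (W z) (cvec_deriv A z) = 0"
    if "z \<in> \<Omega>" for z
  proof -
    show "lprod (W z) (W z) = -1"
    proof (rule identity_theorem_real_line[OF _ _ \<Omega>(1,3) I(1-3) _ that])
      fix t assume t: "t \<in> I"
      have "lprod (W (of_real t)) (W (of_real t)) = of_real (lprod (V t) (V t))"
        by (simp add: lprod_def Wt[OF t])
      then show "lprod (W (of_real t)) (W (of_real t)) = -1"
        using data t by (simp add: bjorling_data_def)
    qed (auto simp: lprod_def intro!: holomorphic_intros holW)
    show "lprod (W z) (cvec_deriv A z) = 0"
    proof (rule identity_theorem_real_line[OF _ _ \<Omega>(1,3) I(1-3) _ that])
      fix t assume t: "t \<in> I"
      have "lprod (W (of_real t)) (cvec_deriv A (of_real t))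
          = of_real (lprod (V t) (vector_derivative \<alpha> (at t)))"
        by (simp add: lprod_def Wt[OF t] dAt[OF t])
      then show "lprod (W (of_real t)) (cvec_deriv A (of_real t)) = 0"
        using data t by (simp add: bjorling_data_def)
    qed (auto simp: lprod_def intro!: holomorphic_intros holW holdA)
  qed
  have "lprod (\<chi> k. deriv (\<Phi> k) z) (\<chi> k. deriv (\<Phi> k) z) = 0" if z: "z \<in> \<Omega>" for z
  proof -
    have "lprod (\<chi> k. deriv (\<Phi> k) z) (\<chi> k. deriv (\<Phi> k) z)
        = lprod (cvec_deriv A z) (cvec_deriv A z) - lprod (B z) (B z)
          + 2 * \<i> * lprod (cvec_deriv A z) (B z)"
      by (simp add: deriv\<Phi>[OF z] lprod_def algebra_simps)
    \<comment> \<open>The first two terms cancel because \<open>W\<close> is unit timelike and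
      orthogonal to \<open>A'\<close>; the last vanishes because a cross product is orthogonal to
      its factors.\<close>
    also have "\<dots> = 0"
      using lcross_unit_orthogonal[OF unit[OF z] orth[OF z]] by (simp add: B_def)
    finally show ?thesis .
  qed
  then have maximal: "maximal_surface \<Omega> X"
    using Re_isotropic_maximal_surface[OF \<Omega>(1) hol\<Phi> rep] by blast
  have "X t 0 = \<alpha> t \<and> nondegenerate_at X t 0 \<and> unit_normal X t 0 = V t" if t: "t \<in> I" for t
  proof -
    let ?a' = "vector_derivative \<alpha> (at t)"
    have t\<Omega>: "Complex t 0 \<in> \<Omega>" using t I(3) by (auto simp: complex_of_real_def)
    \<comment> \<open>The integrand is real on the real axis, so the integral from
      \<open>u\<^sub>0\<close> to \<open>t\<close> is real and, multiplied by \<open>\<i>\<close>,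
      drops out of the real part.\<close>
    have ImP: "Im (P k (of_real t)) = Im (P k (of_real u\<^sub>0))" for k
    proof -
      have "((\<lambda>s. Im (P k (of_real s))) has_vector_derivative 0) (at s within I)" if s: "s \<in> I" for s
      proof -
        have "((\<lambda>s. P k (of_real s)) has_vector_derivative B (of_real s) $ k) (at s)"
          using has_vector_derivative_along_line[OF P has_vector_derivative_complex_of_real] I(3) s by auto
        from bounded_linear.has_vector_derivative[OF bounded_linear_Im this]
        show ?thesis by (simp add: Bt[OF s] has_vector_derivative_at_within)
      qed
      then show ?thesis
        using has_vector_derivative_zero_constant[OF is_interval_convex[OF I(4)]] t u0 by metis
    qed
    have "X t 0 = \<alpha> t"
      using rep[OF t\<Omega>] ImP At[OF t]
      by (simp add: \<Phi>_def vec_eq_iff flip: complex_of_real_def)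
    moreover
    have pdu: "pd_u X t 0 = ?a'" and pdv: "pd_v X t 0 = - lcross (V t) ?a'"
      using Re_holomorphic_pd[OF \<Omega>(1) hol\<Phi> rep t\<Omega>] deriv\<Phi>[OF t\<Omega>] dAt[OF t] Bt[OF t]
      by (simp_all add: vec_eq_iff flip: complex_of_real_def)
    have pos: "lprod ?a' ?a' > 0" and VV: "lprod (V t) (V t) = -1" and Va: "lprod (V t) ?a' = 0"
      using data t by (auto simp: bjorling_data_def)
    note cr = lcross_unit_orthogonal[OF VV Va]
    have neg: "lprod x (- y) = - lprod x y" "lprod (- x) y = - lprod x y" "lcross x (- y) = - lcross x y"
      for x y :: "real^3"
      by (simp_all add: lprod_def lcross_def vec_eq_iff forall_3)
    have "nondegenerate_at X t 0"
      using pos cr by (simp add: nondegenerate_at_def metric_det_def fund_E_def fund_F_def fund_G_def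
          pdu pdv neg)
    moreover
    \<comment> \<open>The factor is positive since \<alpha> is spacelike, so normalizing gives
      \<open>V t\<close> and not its negative.\<close>
    have c: "lcross (pd_u X t 0) (pd_v X t 0) = lprod ?a' ?a' *\<^sub>R V t"
      using cr(3) by (simp add: pdu pdv neg vec_eq_iff)
    have "lprod (e *\<^sub>R x) (e *\<^sub>R x) = e\<^sup>2 * lprod x x" for e and x :: "real^3"
      by (simp add: lprod_def power2_eq_square algebra_simps)
    then have "unit_normal X t 0 = V t"
      using pos by (simp add: unit_normal_def Let_def c VV)
    ultimately show ?thesis by blast
  qed
  then show ?thesis
    using maximal data I(3) by (simp add: solves_bjorling_problem_def)
qed

section \<open>The data along the helix\<close>

lemma sinh_Complex: "sinh (Complex u v) = Complex (sinh u * cos v) (cosh u * sin v)"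
  by (simp add: complex_eq_iff sinh_field_def cosh_field_def Re_exp Im_exp field_simps)

lemma cosh_Complex: "cosh (Complex u v) = Complex (cosh u * cos v) (sinh u * sin v)"
  by (simp add: complex_eq_iff sinh_field_def cosh_field_def Re_exp Im_exp field_simps)

lemma sinh_cosh_of_real:
  "sinh (complex_of_real x) = of_real (sinh x)" "cosh (complex_of_real x) = of_real (cosh x)"
  using sinh_Complex[of x 0] cosh_Complex[of x 0] by (simp_all add: complex_of_real_def)

lemma of_real_mult_Complex: "of_real a * Complex u v = Complex (a * u) (a * v)"
  by (simp add: complex_eq_iff)

definition helix_ext :: "real \<Rightarrow> complex \<Rightarrow> complex^3" where
  "helix_ext lam z = vector [of_real lam * z, cosh z, sinh z]"

definition helix_normal_ext :: "real \<Rightarrow> real \<Rightarrow> real \<Rightarrow> complex \<Rightarrow> complex^3" where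
  "helix_normal_ext a lam \<mu> z = vector
     [- (cosh (of_real a * z) / of_real \<mu>),
      sinh (of_real a * z) * cosh z - of_real lam / of_real \<mu> * (cosh (of_real a * z) * sinh z),
      sinh (of_real a * z) * sinh z - of_real lam / of_real \<mu> * (cosh (of_real a * z) * cosh z)]"

text \<open>Undetermined coefficients: p cosh(az) sinh z - q sinh(az) cosh z has derivative (pa - q)
  sinh(az) sinh z + (p - qa) cosh(az) cosh z. Matching the integrand means pa - q = \<lambda> and p
  - qa = -\<mu>, a system singular at a = 1; there resonance produces the term linear in
  \<open>z\<close>.\<close>

definition helix_primitive :: "real \<Rightarrow> real \<Rightarrow> real \<Rightarrow> complex \<Rightarrow> complex^3" where
  "helix_primitive a lam \<mu> z =
     (if a = 1 then vector
        [cosh z,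
         (of_real (lam - \<mu>) * (sinh z * cosh z) - of_real (lam + \<mu>) * z) / 2,
         of_real (lam - \<mu>) * (sinh z)\<^sup>2 / 2]
      else vector
        [cosh (of_real a * z) / of_real a,
         (of_real (a * lam + \<mu>) * (cosh (of_real a * z) * sinh z)
            - of_real (a * \<mu> + lam) * (sinh (of_real a * z) * cosh z)) / of_real (a\<^sup>2 - 1),
         (of_real (a * lam + \<mu>) * (cosh (of_real a * z) * cosh z)
            - of_real (a * \<mu> + lam) * (sinh (of_real a * z) * sinh z)) / of_real (a\<^sup>2 - 1)])"

lemma holomorphic_sinh_cosh_scaled:
  "(\<lambda>z. sinh (c * z)) holomorphic_on S" "(\<lambda>z. cosh (c * z)) holomorphic_on S" for c :: complex
  by (intro analytic_imp_holomorphic analytic_intros)+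

lemmas holomorphic_sinh_cosh =
  holomorphic_sinh_cosh_scaled holomorphic_sinh_cosh_scaled[of 1, simplified]

lemma helix_ext_holomorphic_extension:
  assumes "\<And>t. \<alpha> t = vector [lam * t, cosh t, sinh t]"
  shows "holomorphic_extension I \<Omega> \<alpha> (helix_ext lam)"
  unfolding holomorphic_extension_def helix_ext_def forall_3 vector_3 assms
  by (auto intro!: holomorphic_intros holomorphic_sinh_cosh simp: sinh_cosh_of_real)

lemma helix_normal_ext_holomorphic_extension:
  fixes n b V :: "real \<Rightarrow> real^3"
  assumes "\<And>t. n t = vector [0, cosh t, sinh t]"
    and "\<And>t. b t = (- (1 / \<mu>)) *\<^sub>R vector [1, lam * sinh t, lam * cosh t]"
    and "\<And>t. V t = sinh (a * t) *\<^sub>R n t + cosh (a * t) *\<^sub>R b t"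
    and "\<mu> \<noteq> 0"
  shows "holomorphic_extension I \<Omega> V (helix_normal_ext a lam \<mu>)"
proof -
  have "cosh (complex_of_real a * of_real t) = of_real (cosh (a * t))"
    "sinh (complex_of_real a * of_real t) = of_real (sinh (a * t))" for t
    by (simp_all flip: sinh_cosh_of_real)
  then show ?thesis
    unfolding holomorphic_extension_def helix_normal_ext_def forall_3 assms(1-3)
    using assms(4)
    by (auto intro!: holomorphic_intros holomorphic_sinh_cosh simp: sinh_cosh_of_real)
qed

lemma cvec_deriv_helix_ext: "cvec_deriv (helix_ext lam) z = vector [of_real lam, sinh z, cosh z]"
  unfolding vec_eq_iff forall_3 cvec_deriv_def helix_ext_def
  by (auto intro!: DERIV_imp_deriv derivative_eq_intros)

lemma lcross_helix_ext:
  assumes "\<mu> \<noteq> 0" and "\<mu>\<^sup>2 = lam\<^sup>2 - 1"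
  shows "lcross (helix_normal_ext a lam \<mu> z) (cvec_deriv (helix_ext lam) z) = vector
     [sinh (of_real a * z),
      of_real lam * (sinh (of_real a * z) * sinh z) - of_real \<mu> * (cosh (of_real a * z) * cosh z),
      of_real lam * (sinh (of_real a * z) * cosh z) - of_real \<mu> * (cosh (of_real a * z) * sinh z)]"
proof -
  define m l where "m = complex_of_real \<mu>" and "l = complex_of_real lam"
  have m: "m \<noteq> 0" and ml: "m * m = l * l - 1"
    using assms by (auto simp: m_def l_def power2_eq_square simp flip: of_real_mult)
  \<comment> \<open>The first coordinate: the terms with \<open>l / m\<close> cancel, and C^2 - S^2
    = 1 does the rest.\<close>
  have 1: "s * C * C - l / m * (c * S) * C - (s * S - l / m * (c * C)) * S = s"
    if "C\<^sup>2 - S\<^sup>2 = 1" for s c S C :: complex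
  proof -
    have "s * C * C - l / m * (c * S) * C - (s * S - l / m * (c * C)) * S = s * (C\<^sup>2 - S\<^sup>2)"
      by (simp add: algebra_simps power2_eq_square)
    then show ?thesis using that by simp
  qed
  \<comment> \<open>Common shape of the second and third coordinates;
    \<open>l * l - 1 = m * m\<close> turns the quotient by \<open>m\<close> into a factor
    \<open>m\<close>.\<close>
  have 2: "(x - l / m * (c * y)) * l + c / m * y = l * x - m * (c * y)" for x y c :: complex
  proof -
    have "(x - l / m * (c * y)) * l + c / m * y = l * x - (l * l - 1) / m * (c * y)"
      using m by (simp add: field_simps)
    also have "\<dots> = l * x - m * (c * y)"
      using m by (simp flip: ml)
    finally show ?thesis .
  qed
  show ?thesis
    unfolding cvec_deriv_helix_ext helix_normal_ext_def lcross_def vec_eq_iff forall_3 vector_3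
      m_def[symmetric] l_def[symmetric]
    using 1[of "cosh z" "sinh z" "sinh (of_real a * z)" "cosh (of_real a * z)"] hyperbolic_pythagoras[of z]
      2[of "sinh (of_real a * z) * sinh z" "cosh (of_real a * z)" "cosh z"]
      2[of "sinh (of_real a * z) * cosh z" "cosh (of_real a * z)" "sinh z"]
    by (simp add: algebra_simps)
qed

lemma helix_primitive_derivative:
  assumes "a > 0" and "\<mu> \<noteq> 0" and "\<mu>\<^sup>2 = lam\<^sup>2 - 1"
  shows "((\<lambda>z. helix_primitive a lam \<mu> z $ k) has_field_derivative
    lcross (helix_normal_ext a lam \<mu> z) (cvec_deriv (helix_ext lam) z) $ k) (at z)"
proof (cases "a = 1")
  case True
  \<comment> \<open>Needed because differentiating \<open>sinh z * cosh z\<close> mixes both squares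
    with the constant from the linear term.\<close>
  have "sinh z * sinh z = cosh z * cosh z - 1"
    using hyperbolic_pythagoras[of z] by (simp add: power2_eq_square algebra_simps)
  then have "\<forall>k. ((\<lambda>z. helix_primitive a lam \<mu> z $ k) has_field_derivative
    lcross (helix_normal_ext a lam \<mu> z) (cvec_deriv (helix_ext lam) z) $ k) (at z)"
    unfolding lcross_helix_ext[OF assms(2,3)] helix_primitive_def forall_3 
    by (auto simp: True power2_eq_square intro!: derivative_eq_intros; simp add: algebra_simps)
  then show ?thesis by blast
next
  case False
  define A p q c where "A = complex_of_real a" and "p = complex_of_real (a * lam + \<mu>)"
    and "q = complex_of_real (a * \<mu> + lam)" and "c = complex_of_real (a\<^sup>2 - 1)"
  note defs = A_def p_def q_def c_def
  \<comment> \<open>Of the roots 1 and -1, the case assumption excludes the first and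
    \<open>a > 0\<close> the second.\<close>
  have "a\<^sup>2 - 1 \<noteq> 0"
    using False assms(1) by (simp add: power2_eq_1_iff)
  then have c: "c \<noteq> 0"
    unfolding c_def of_real_eq_0_iff .
  have A: "A \<noteq> 0"
    using assms(1) by (simp add: A_def)
  have pq: "(p * A - q) / c = of_real lam" "(p - q * A) / c = - of_real \<mu>"
    unfolding divide_eq_eq using c
    by (simp_all add: defs power2_eq_square algebra_simps)
  \<comment> \<open>By the product rule both remaining derivatives have the left-hand shape:
    \<open>x\<close>, \<open>y\<close> stand for \<open>sinh (A * z) * sinh z\<close>,
    \<open>cosh (A * z) * cosh z\<close> in the second coordinate, and for
    \<open>sinh (A * z) * cosh z\<close>, \<open>cosh (A * z) * sinh z\<close> in the third.\<close>
  have "(p * (A * x + y) - q * (A * y + x)) / c = (p * A - q) / c * x + (p - q * A) / c * y" for x y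
    using c by (simp add: field_simps)
  then have comb: "(p * (A * x + y) - q * (A * y + x)) / c = of_real lam * x - of_real \<mu> * y" for x y
    unfolding pq by simp
  have "((\<lambda>z. cosh (A * z) / A) has_field_derivative sinh (A * z)) (at z)"
    using A by (auto intro!: derivative_eq_intros)
  moreover have "((\<lambda>z. (p * (cosh (A * z) * sinh z) - q * (sinh (A * z) * cosh z)) / c) has_field_derivative
      of_real lam * (sinh (A * z) * sinh z) - of_real \<mu> * (cosh (A * z) * cosh z)) (at z)"
    unfolding comb[symmetric] using c by (auto intro!: derivative_eq_intros simp: mult_ac add_ac)
  moreover have "((\<lambda>z. (p * (cosh (A * z) * cosh z) - q * (sinh (A * z) * sinh z)) / c) has_field_derivative
      of_real lam * (sinh (A * z) * cosh z) - of_real \<mu> * (cosh (A * z) * sinh z)) (at z)"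
    unfolding comb[symmetric] using c by (auto intro!: derivative_eq_intros simp: mult_ac add_ac)
  ultimately have "\<forall>k. ((\<lambda>z. helix_primitive a lam \<mu> z $ k) has_field_derivative
    lcross (helix_normal_ext a lam \<mu> z) (cvec_deriv (helix_ext lam) z) $ k) (at z)"
    unfolding lcross_helix_ext[OF assms(2,3)] helix_primitive_def forall_3 defs
    using False by simp
  then show ?thesis by blast
qed

section \<open>Explicit coordinates of the helix surface\<close>

lemma Re_i_times_diff: "Re (x + \<i> * (y - z)) = Re x - Im y + Im z"
  by simp

text \<open>Applied at \<open>u\<^sub>0\<close>, it makes the integration constant disappear, so the
  coordinates do not depend on the base point.\<close>

lemma Im_helix_primitive_of_real: "Im (helix_primitive a lam \<mu> (of_real t) $ k) = 0"
proof -
  have "\<forall>k. Im (helix_primitive a lam \<mu> (of_real t) $ k) = 0"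
    unfolding helix_primitive_def forall_3
    by (simp add: sinh_cosh_of_real Im_divide_of_real power2_eq_square flip: of_real_mult)
  then show ?thesis by blast
qed

theorem mainTheorem4:
  fixes a lam \<mu> u\<^sub>0 :: real and \<alpha> n b V :: "real \<Rightarrow> real^3"
  assumes "a > 0" and "lam > 1" and "\<mu> = sqrt (lam\<^sup>2 - 1)"
    and "\<And>t. \<alpha> t = vector [lam * t, cosh t, sinh t]"
    and "\<And>t. n t = vector [0, cosh t, sinh t]"
    and "\<And>t. b t = (- (1 / \<mu>)) *\<^sub>R vector [1, lam * sinh t, lam * cosh t]"
    and "\<And>t. V t = sinh (a * t) *\<^sub>R n t + cosh (a * t) *\<^sub>R b t"
  shows "(\<exists>!X. bjorling_surface UNIV \<alpha> V UNIV u\<^sub>0 X) \<and>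
    (\<forall>\<Omega> X. bjorling_surface UNIV \<alpha> V \<Omega> u\<^sub>0 X \<longrightarrow>
      solves_bjorling_problem UNIV \<alpha> V \<Omega> X \<and>
      (a \<noteq> 1 \<longrightarrow> (\<forall>u v. Complex u v \<in> \<Omega> \<longrightarrow>
        X u v $ 1 = lam * u - sinh (a * u) * sin (a * v) / a \<and>
        X u v $ 2 =
          cosh u * ((a\<^sup>2 - 1) * cos v + cosh (a * u) *
            ((a * \<mu> + lam) * cos v * sin (a * v) - (a * lam + \<mu>) * sin v * cos (a * v))) / (a\<^sup>2 - 1)
          + sinh u * sinh (a * u) *
            ((a * \<mu> + lam) * sin v * cos (a * v) - (a * lam + \<mu>) * cos v * sin (a * v)) / (a\<^sup>2 - 1) \<and>
        X u v $ 3 =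
          sinh u * ((a\<^sup>2 - 1) * cos v + cosh (a * u) *
            ((a * \<mu> + lam) * cos v * sin (a * v) - (a * lam + \<mu>) * sin v * cos (a * v))) / (a\<^sup>2 - 1)
          + cosh u * sinh (a * u) *
            ((a * \<mu> + lam) * sin v * cos (a * v) - (a * lam + \<mu>) * cos v * sin (a * v)) / (a\<^sup>2 - 1))) \<and>
      (a = 1 \<longrightarrow> (\<forall>u v. Complex u v \<in> \<Omega> \<longrightarrow>
        X u v $ 1 = lam * u - sinh u * sin v \<and>
        X u v $ 2 = 1 / 2 * ((\<mu> - lam) * ((sinh u)\<^sup>2 + (cosh u)\<^sup>2) * sin v * cos v
                      + 2 * cosh u * cos v + (\<mu> + lam) * v) \<and>
        X u v $ 3 = sinh u * cos v * ((\<mu> - lam) * cosh u * sin v + 1))))"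
proof -
  have lam: "lam\<^sup>2 > 1"
    using assms(2) by (simp add: one_less_power)
  with assms(3) have \<mu>: "\<mu> > 0" "\<mu>\<^sup>2 = lam\<^sup>2 - 1"
    by simp_all
  then have \<mu>0: "\<mu> \<noteq> 0" by simp
  note extensions = helix_ext_holomorphic_extension[OF assms(4)]
    helix_normal_ext_holomorphic_extension[OF assms(5-7) \<mu>0]
  note prim = helix_primitive_derivative[OF assms(1) \<mu>0 \<mu>(2)]
  \<comment> \<open>\<open>Y\<close> is defined on the whole plane, and every Bjoerling surface with
    these data agrees with it on its own domain. Existence, uniqueness and the coordinate formulas
    all reduce to \<open>Y\<close>.\<close>
  define Y where "Y u v = (\<chi> k. Re (helix_ext lam (Complex u v) $ k
    + \<i> * (helix_primitive a lam \<mu> (Complex u v) $ k - helix_primitive a lam \<mu> (of_real u\<^sub>0) $ k)))" for u v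
  have rep: "X u v = Y u v" if "bjorling_surface UNIV \<alpha> V \<Omega> u\<^sub>0 X" "Complex u v \<in> \<Omega>" for X \<Omega> u v
    unfolding Y_def
    by (rule bjorling_surface_primitive[OF that(1) extensions, where P = "\<lambda>k z. helix_primitive a lam \<mu> z $ k"])
      (use that prim in auto)
  have vd: "vector_derivative \<alpha> (at t) = vector [lam, sinh t, cosh t]" for t
  proof -
    have "complex_of_real (vector_derivative \<alpha> (at t) $ k) = of_real (vector [lam, sinh t, cosh t] $ k)" for k
      using holomorphic_extension_deriv(1)[OF extensions(1)[where I = UNIV and \<Omega> = UNIV], of t k] exhaust_3[of k]
      by (auto simp: cvec_deriv_helix_ext sinh_cosh_of_real)
    then show ?thesis by (simp add: vec_eq_iff)
  qed
  \<comment> \<open>Here \<open>n\<close> is unit spacelike, \<open>b\<close> is unit timelike, and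
    both are orthogonal to \<alpha>' and to each other; hence <V, V> = sinh^2(at) - cosh^2(at) =
    -1.\<close>
  have "lprod (vector_derivative \<alpha> (at t)) (vector_derivative \<alpha> (at t)) = \<mu>\<^sup>2
      \<and> lprod (V t) (V t) = -1 \<and> lprod (V t) (vector_derivative \<alpha> (at t)) = 0" for t
  proof -
    have C: "cosh t * cosh t = sinh t * sinh t + 1"
      and C': "cosh (a * t) * cosh (a * t) = sinh (a * t) * sinh (a * t) + 1"
      using hyperbolic_pythagoras[of t] hyperbolic_pythagoras[of "a * t"]
      by (simp_all add: power2_eq_square)
    have "lprod (vector_derivative \<alpha> (at t)) (vector_derivative \<alpha> (at t)) = \<mu>\<^sup>2"
      using C \<mu>(2) by (simp add: vd lprod_def power2_eq_square)
    moreover have n: "lprod (n t) (n t) = 1" "lprod (n t) (b t) = 0" "lprod (n t) (vector_derivative \<alpha> (at t)) = 0"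
      using C by (simp_all add: assms(5,6) vd lprod_def)
    moreover have "lprod (b t) (vector_derivative \<alpha> (at t)) = - 1 / \<mu> * (lam * (1 + sinh t * sinh t - cosh t * cosh t))"
      by (simp add: assms(6) vd lprod_def algebra_simps add_divide_distrib diff_divide_distrib)
    then have "lprod (b t) (vector_derivative \<alpha> (at t)) = 0"
      using C by simp
    moreover have "lprod (b t) (b t) = (1 + lam\<^sup>2 * (sinh t * sinh t - cosh t * cosh t)) / \<mu>\<^sup>2"
      by (simp add: assms(6) lprod_def power2_eq_square algebra_simps add_divide_distrib diff_divide_distrib)
    then have "lprod (b t) (b t) = -1"
      using C \<mu>(2) lam by (simp add: divide_eq_eq)
    moreover have "lprod (x *\<^sub>R n t + y *\<^sub>R b t) (x *\<^sub>R n t + y *\<^sub>R b t)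
        = x * x * lprod (n t) (n t) + 2 * x * y * lprod (n t) (b t) + y * y * lprod (b t) (b t)"
      "lprod (x *\<^sub>R n t + y *\<^sub>R b t) w = x * lprod (n t) w + y * lprod (b t) w" for x y w
      by (simp_all add: lprod_def algebra_simps)
    ultimately show ?thesis
      using C' by (simp add: assms(7))
  qed
  \<comment> \<open>Real analyticity of both curves is read off from their entire
    extensions.\<close>
  then have data: "bjorling_data UNIV \<alpha> V"
    using \<mu>(1) holomorphic_extension_real_analytic[OF extensions(1)[where I = UNIV and \<Omega> = UNIV]]
      holomorphic_extension_real_analytic[OF extensions(2)[where I = UNIV and \<Omega> = UNIV]]
    by (simp add: bjorling_data_def)
  have "simply_connected (UNIV :: complex set)"
    by (simp add: convex_imp_simply_connected)
  then have "bjorling_surface UNIV \<alpha> V UNIV u\<^sub>0 Y"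
    unfolding Y_def[abs_def]
    by (intro bjorling_surface_exists[where P = "\<lambda>k z. helix_primitive a lam \<mu> z $ k", OF data _ _ _ _ extensions]
        prim) auto
  then have "\<exists>!X. bjorling_surface UNIV \<alpha> V UNIV u\<^sub>0 X"
  \<comment> \<open>Over all of \<open>UNIV\<close> agreement on the domain is equality of
    functions; on a smaller domain the values outside would be arbitrary.\<close>
  proof (rule ex1I[where a = Y])
    show "X = Y" if "bjorling_surface UNIV \<alpha> V UNIV u\<^sub>0 X" for X
      by (intro ext rep[OF that]) simp
  qed
  moreover have Y: "Y u v $ k = Re (helix_ext lam (Complex u v) $ k) - Im (helix_primitive a lam \<mu> (Complex u v) $ k)"
    for u v k
    unfolding Y_def vec_lambda_beta Re_i_times_diff Im_helix_primitive_of_real by simp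
  have ne1: "X u v $ 1 = lam * u - sinh (a * u) * sin (a * v) / a \<and>
        X u v $ 2 =
          cosh u * ((a\<^sup>2 - 1) * cos v + cosh (a * u) *
            ((a * \<mu> + lam) * cos v * sin (a * v) - (a * lam + \<mu>) * sin v * cos (a * v))) / (a\<^sup>2 - 1)
          + sinh u * sinh (a * u) *
            ((a * \<mu> + lam) * sin v * cos (a * v) - (a * lam + \<mu>) * cos v * sin (a * v)) / (a\<^sup>2 - 1) \<and>
        X u v $ 3 =
          sinh u * ((a\<^sup>2 - 1) * cos v + cosh (a * u) *
            ((a * \<mu> + lam) * cos v * sin (a * v) - (a * lam + \<mu>) * sin v * cos (a * v))) / (a\<^sup>2 - 1)
          + cosh u * sinh (a * u) *
            ((a * \<mu> + lam) * sin v * cos (a * v) - (a * lam + \<mu>) * cos v * sin (a * v)) / (a\<^sup>2 - 1)"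
    if "a \<noteq> 1" "bjorling_surface UNIV \<alpha> V \<Omega> u\<^sub>0 X" "Complex u v \<in> \<Omega>" for \<Omega> u v and X :: "real \<Rightarrow> real \<Rightarrow> real^3"
  proof -
    \<comment> \<open>Real constants pass through \<open>Im\<close>; kept as single symbols, with
      \<open>c\<close> nonzero, they reduce the claim to clearing denominators.\<close>
    define c p q where "c = a\<^sup>2 - 1" and "p = a * lam + \<mu>" and "q = a * \<mu> + lam"
    have "c \<noteq> 0"
      using that(1) assms(1) by (simp add: c_def power2_eq_1_iff)
    then show ?thesis
      unfolding rep[OF that(2,3)] Y helix_ext_def helix_primitive_def of_real_mult_Complex sinh_Complex cosh_Complex
        c_def[symmetric] p_def[symmetric] q_def[symmetric] Im_divide_of_real
      using that(1) assms(1)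
      by (simp add: Im_divide_of_real field_simps)
  qed
  have eq1: "X u v $ 1 = lam * u - sinh u * sin v \<and>
        X u v $ 2 = 1 / 2 * ((\<mu> - lam) * ((sinh u)\<^sup>2 + (cosh u)\<^sup>2) * sin v * cos v
                      + 2 * cosh u * cos v + (\<mu> + lam) * v) \<and>
        X u v $ 3 = sinh u * cos v * ((\<mu> - lam) * cosh u * sin v + 1)"
    if "a = 1" "bjorling_surface UNIV \<alpha> V \<Omega> u\<^sub>0 X" "Complex u v \<in> \<Omega>" for \<Omega> u v and X :: "real \<Rightarrow> real \<Rightarrow> real^3"
    unfolding rep[OF that(2,3)] Y helix_ext_def helix_primitive_def sinh_Complex cosh_Complex power2_eq_square
    using that(1) by (simp add: algebra_simps add_divide_distrib diff_divide_distrib)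
  ultimately show ?thesis
    using bjorling_surface_solves_problem ne1 eq1 by blast
qed

end
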